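(* Let $x\in\mathbb{R}$ be the initial state. Suppose that for every $\mu\in\Lambda$ there can be found a value $\phi_\mu(x)$ and a control $u_\mu^*\in\mathcal{A}$ solving the unconstrained stochastic control problem $$\phi_\mu(x)=\sup_{u\in\mathcal{A}}E^x\Big[\int_0^T f(t,X_u(t),u(t))\,dt+g(X_u(T))+\mu\,M(X_u(T))\Big]$$ (that is, the supremum is attained at $u_\mu^*$), where $X_u$ denotes the solution of $$dX(t)=b(t,X(t),u(t))\,dt+\sigma(t,X(t),u(t))\,dB(t)+\int_{\mathbb{R}}\gamma(t,X(t^-),u(t^-),z)\,\tilde N(dt,dz),\qquad X(0)=x.$$ Suppose moreover that there exists $\mu_0\in\Lambda$ such that $$M\big(X_{u_{\mu_0}^*}(T)\big)=0\quad\text{a.s.}$$ Then $\phi(x):=\phi_{\mu_0}(x)$ and $u^*:=u_{\mu_0}^*$ solve the constrained stochastic control problem $$\phi(x)=\sup\Big\{E^x\Big[\int_0^T f(t,X_u(t),u(t))\,dt+g(X_u(T))\Big]\;:\;u\in\mathcal{A},\ M(X_u(T))=0\ \text{a.s.}\Big\},$$ that is, $u_{\mu_0}^*$ is feasible for this problem and attains its supremum, and the value of the supremum is $\phi_{\mu_0}(x)$.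
   Context: Let $(\Omega,\mathcal{F},P)$ be a probability space, $T>0$, $\{B(t)\}_{t\in[0,T]}$ a Brownian motion, and $\int_{\mathbb{R}}z\,\tilde N(dt,dz)$ a pure jump process independent of $B$, where $\tilde N(dt,dz)=N(dt,dz)-\nu(dz)\,dt$ is a compensated Poisson random measure with Lévy measure $\nu$. Let $\{\mathcal{F}_t\}_{t\in[0,T]}$ be the filtration generated by $B$ and the pure jump process; adapted means adapted to this filtration. Let $f:\mathbb{R}_+\times\mathbb{R}\times\mathbb{R}\to\mathbb{R}$, $g:\mathbb{R}\to\mathbb{R}$ and $M:\mathbb{R}\to\mathbb{R}$ be given continuous functions, $\mathcal{U}\subset\mathbb{R}$ a given set, and $b:\mathbb{R}_+\times\mathbb{R}\times\mathcal{U}\to\mathbb{R}$, $\sigma:\mathbb{R}_+\times\mathbb{R}\times\mathcal{U}\to\mathbb{R}$, $\gamma:\mathbb{R}_+\times\mathbb{R}\times\mathcal{U}\times\mathbb{R}\to\mathbb{R}$ given functions. $E^x[\cdot]$ denotes expectation given that the state process starts in $X(0)=x$. A control is a stochastic process $u(t)=u(t,\omega):\mathbb{R}_+\times\Omega\to\mathcal{U}$. It is admissible, written $u\in\mathcal{A}$, if the stochastic differential equation for $X$ displayed in the claim has a unique strong solution $X_u$ for all $x\in\mathbb{R}$ and $E^x[\int_0^T f(t,X_u(t),u(t))\,dt+g(X_u(T))]<\infty$. It is assumed that $E^x[M(X_u(T))]<\infty$ for all $u\in\mathcal{A}$. The set of stochastic multipliers is $$\Lambda:=\{\mu:\Omega\to\mathbb{R}\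 |\ \mu\text{ is }\mathcal{F}_T\text{-measurable and }E[\mu]<\infty\}.$$ *)

theory Defs
  imports "HOL-Probability.Probability"
begin

section \<open>Driving noise\<close>

definition brownian_motion :: "'a measure \<Rightarrow> real \<Rightarrow> (real \<Rightarrow> 'a \<Rightarrow> real) \<Rightarrow> bool" where
  "brownian_motion P T B \<longleftrightarrow>
     (\<forall>t\<in>{0..T}. B t \<in> borel_measurable P) \<and>
     (AE \<omega> in P. B 0 \<omega> = 0) \<and>
     (\<forall>s t. 0 \<le> s \<and> s < t \<and> t \<le> T \<longrightarrow>
        distributed P lborel (\<lambda>\<omega>. B t \<omega> - B s \<omega>) (normal_density 0 (sqrt (t - s)))) \<and>
     (\<forall>(n::nat) \<tau>. (\<forall>i\<le>n. \<tau> i \<in> {0..T}) \<and> (\<forall>i<n. \<tau> i \<le> \<tau> (Suc i)) \<longrightarrow>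
        prob_space.indep_vars P (\<lambda>_. borel) (\<lambda>i \<omega>. B (\<tau> (Suc i)) \<omega> - B (\<tau> i) \<omega>) {..<n}) \<and>
     (AE \<omega> in P. continuous_on {0..T} (\<lambda>t. B t \<omega>))"

definition levy_measure :: "real measure \<Rightarrow> bool" where
  "levy_measure \<nu> \<longleftrightarrow>
     sets \<nu> = sets borel \<and> emeasure \<nu> {0} = 0 \<and> (\<integral>\<^sup>+z. ennreal (min 1 (z\<^sup>2)) \<partial>\<nu>) < \<infinity>"

definition poisson_random_measure :: "'a measure \<Rightarrow> 'b measure \<Rightarrow> ('a \<Rightarrow> 'b measure) \<Rightarrow> bool" where
  "poisson_random_measure P m N \<longleftrightarrow>
     (\<forall>\<omega>\<in>space P. sets (N \<omega>) = sets m) \<and>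
     (\<forall>A\<in>sets m. (\<lambda>\<omega>. emeasure (N \<omega>) A) \<in> borel_measurable P) \<and>
     (\<forall>A\<in>sets m. emeasure m A < \<infinity> \<longrightarrow>
        (\<forall>k::nat. measure P {\<omega>\<in>space P. emeasure (N \<omega>) A = of_nat k}
           = measure m A ^ k / fact k * exp (- measure m A))) \<and>
     (\<forall>A::nat \<Rightarrow> 'b set. range A \<subseteq> sets m \<and> disjoint_family A \<longrightarrow>
        prob_space.indep_vars P (\<lambda>_. borel) (\<lambda>i \<omega>. emeasure (N \<omega>) (A i)) UNIV)"

definition process_events ::
  "'a measure \<Rightarrow> (real \<Rightarrow> 'a \<Rightarrow> real) \<Rightarrow> real \<Rightarrow> 'a set set" where
  "process_events P X t = {X s -` S \<inter> space P | s S. s \<in> {0..t} \<and> S \<in> sets borel}"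

text \<open>The filtration generated by two processes, augmented by the null sets of \<open>P\<close>. The
  augmentation makes stochastic integrals, which are only determined up to null sets, adapted.\<close>

definition generated_filtration ::
  "'a measure \<Rightarrow> (real \<Rightarrow> 'a \<Rightarrow> real) \<Rightarrow> (real \<Rightarrow> 'a \<Rightarrow> real) \<Rightarrow> real \<Rightarrow> 'a measure" where
  "generated_filtration P B \<eta> t =
     sigma (space P) (process_events P B t \<union> process_events P \<eta> t \<union> null_sets P)"


section \<open>Stochastic integrals\<close>

definition vanishes_in_prob :: "'a measure \<Rightarrow> (nat \<Rightarrow> 'a \<Rightarrow> ennreal) \<Rightarrow> bool" where
  "vanishes_in_prob P D \<longleftrightarrow>
     (\<forall>\<epsilon>>0. (\<lambda>n. measure P {\<omega>\<in>space P. D n \<omega> > ennreal \<epsilon>}) \<longlonglongrightarrow> 0)"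

text \<open>A list of triples \<open>(s, r, \<xi>)\<close> encodes the simple process that is the sum of the
  \<open>\<xi> 1\<^bsub>(s, r]\<^esub>\<close>, where \<open>\<xi>\<close> is bounded and measurable at time \<open>s\<close>.\<close>

definition simple_integrand ::
  "'a measure \<Rightarrow> real \<Rightarrow> (real \<Rightarrow> 'a measure) \<Rightarrow> (real \<times> real \<times> ('a \<Rightarrow> real)) list \<Rightarrow> bool" where
  "simple_integrand P T F hs \<longleftrightarrow>
     (\<forall>(s, r, \<xi>)\<in>set hs. 0 \<le> s \<and> s \<le> r \<and> r \<le> T \<and>
        \<xi> \<in> borel_measurable (F s) \<and> bounded (\<xi> ` space P))"

definition simple_process :: "(real \<times> real \<times> ('a \<Rightarrow> real)) list \<Rightarrow> real \<Rightarrow> 'a \<Rightarrow> real" where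
  "simple_process hs t \<omega> = (\<Sum>(s, r, \<xi>)\<leftarrow>hs. \<xi> \<omega> * indicator {s<..r} t)"

definition simple_ito ::
  "(real \<Rightarrow> 'a \<Rightarrow> real) \<Rightarrow> (real \<times> real \<times> ('a \<Rightarrow> real)) list \<Rightarrow> real \<Rightarrow> 'a \<Rightarrow> real" where
  "simple_ito B hs t \<omega> = (\<Sum>(s, r, \<xi>)\<leftarrow>hs. \<xi> \<omega> * (B (min r t) \<omega> - B (min s t) \<omega>))"

text \<open>\<open>I t\<close> is a version of the integral of \<open>H\<close> against \<open>B\<close> over \<open>[0, t]\<close>, for every \<open>t\<close>
  in \<open>[0, T]\<close>: the usual extension of the integral from simple processes, by convergence in
  probability, to adapted processes with almost surely square integrable paths.\<close>

definition ito_integral ::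
  "'a measure \<Rightarrow> real \<Rightarrow> (real \<Rightarrow> 'a measure) \<Rightarrow> (real \<Rightarrow> 'a \<Rightarrow> real) \<Rightarrow>
     (real \<Rightarrow> 'a \<Rightarrow> real) \<Rightarrow> (real \<Rightarrow> 'a \<Rightarrow> real) \<Rightarrow> bool" where
  "ito_integral P T F B H I \<longleftrightarrow>
     (\<lambda>(t, \<omega>). H t \<omega>) \<in> borel_measurable (restrict_space borel {0..T} \<Otimes>\<^sub>M P) \<and>
     (\<forall>t\<in>{0..T}. H t \<in> borel_measurable (F t)) \<and>
     (AE \<omega> in P. (\<integral>\<^sup>+t\<in>{0..T}. ennreal ((H t \<omega>)\<^sup>2) \<partial>lborel) < \<infinity>) \<and>
     (\<forall>t\<in>{0..T}. I t \<in> borel_measurable P) \<and>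
     (\<exists>hs. (\<forall>n. simple_integrand P T F (hs n)) \<and>
        vanishes_in_prob P
          (\<lambda>n \<omega>. \<integral>\<^sup>+t\<in>{0..T}. ennreal ((H t \<omega> - simple_process (hs n) t \<omega>)\<^sup>2) \<partial>lborel) \<and>
        (\<forall>t\<in>{0..T}. vanishes_in_prob P (\<lambda>n \<omega>. ennreal \<bar>simple_ito B (hs n) t \<omega> - I t \<omega>\<bar>)))"

definition predictable :: "'a measure \<Rightarrow> real \<Rightarrow> (real \<Rightarrow> 'a measure) \<Rightarrow> (real \<times> 'a) measure" where
  "predictable P T F =
     sigma ({0<..T} \<times> space P)
       {{s<..r} \<times> A | s r A. 0 \<le> s \<and> s \<le> r \<and> r \<le> T \<and> A \<in> sets (F s)}"

text \<open>A list of quadruples \<open>(s, r, A, \<xi>)\<close> encodes the sum of the \<open>\<xi> 1\<^bsub>(s, r]\<^esub>(t) 1\<^bsub>A\<^esub>(z)\<close>.\<close>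

definition simple_jump_integrand ::
  "'a measure \<Rightarrow> real \<Rightarrow> (real \<Rightarrow> 'a measure) \<Rightarrow> real measure \<Rightarrow>
     (real \<times> real \<times> real set \<times> ('a \<Rightarrow> real)) list \<Rightarrow> bool" where
  "simple_jump_integrand P T F \<nu> hs \<longleftrightarrow>
     (\<forall>(s, r, A, \<xi>)\<in>set hs. 0 \<le> s \<and> s \<le> r \<and> r \<le> T \<and> A \<in> sets \<nu> \<and> emeasure \<nu> A < \<infinity> \<and>
        \<xi> \<in> borel_measurable (F s) \<and> bounded (\<xi> ` space P))"

definition simple_jump_process ::
  "(real \<times> real \<times> real set \<times> ('a \<Rightarrow> real)) list \<Rightarrow> real \<Rightarrow> 'a \<Rightarrow> real \<Rightarrow> real" where
  "simple_jump_process hs t \<omega> z =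
     (\<Sum>(s, r, A, \<xi>)\<leftarrow>hs. \<xi> \<omega> * indicator {s<..r} t * indicator A z)"

definition simple_compensated ::
  "('a \<Rightarrow> (real \<times> real) measure) \<Rightarrow> real measure \<Rightarrow>
     (real \<times> real \<times> real set \<times> ('a \<Rightarrow> real)) list \<Rightarrow> real \<Rightarrow> 'a \<Rightarrow> real" where
  "simple_compensated N \<nu> hs t \<omega> =
     (\<Sum>(s, r, A, \<xi>)\<leftarrow>hs. \<xi> \<omega> *
        (measure (N \<omega>) ({min s t<..min r t} \<times> A) - (min r t - min s t) * measure \<nu> A))"

text \<open>\<open>J t\<close> is a version of the integral of \<open>\<phi>\<close> against the compensated random measure over
  \<open>(0, t] \<times> \<real>\<close>. The size of an integrand is measured with \<open>min \<bar>\<phi>\<bar> \<phi>\<^sup>2\<close> rather than \<open>\<phi>\<^sup>2\<close>: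
  this is the full class for which the compensated integral exists; it contains the predictable
  integrands with almost surely finite square integral, and it contains \<open>\<phi> = z\<close> also when \<open>\<nu>\<close>
  has no second moment.\<close>

definition jump_size :: "real \<Rightarrow> real" where
  "jump_size y = min \<bar>y\<bar> (y\<^sup>2)"

definition compensated_integral ::
  "'a measure \<Rightarrow> real \<Rightarrow> (real \<Rightarrow> 'a measure) \<Rightarrow> ('a \<Rightarrow> (real \<times> real) measure) \<Rightarrow> real measure \<Rightarrow>
     (real \<Rightarrow> 'a \<Rightarrow> real \<Rightarrow> real) \<Rightarrow> (real \<Rightarrow> 'a \<Rightarrow> real) \<Rightarrow> bool" where
  "compensated_integral P T F N \<nu> \<phi> J \<longleftrightarrow>
     (\<lambda>((t, \<omega>), z). \<phi> t \<omega> z) \<in> borel_measurable (predictable P T F \<Otimes>\<^sub>M borel) \<and>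
     (AE \<omega> in P. (\<integral>\<^sup>+t\<in>{0<..T}. (\<integral>\<^sup>+z. ennreal (jump_size (\<phi> t \<omega> z)) \<partial>\<nu>) \<partial>lborel) < \<infinity>) \<and>
     (\<forall>t\<in>{0..T}. J t \<in> borel_measurable P) \<and>
     (\<exists>hs. (\<forall>n. simple_jump_integrand P T F \<nu> (hs n)) \<and>
        vanishes_in_prob P
          (\<lambda>n \<omega>. \<integral>\<^sup>+t\<in>{0<..T}.
             (\<integral>\<^sup>+z. ennreal (jump_size (\<phi> t \<omega> z - simple_jump_process (hs n) t \<omega> z)) \<partial>\<nu>)
             \<partial>lborel) \<and>
        (\<forall>t\<in>{0..T}. vanishes_in_prob P
          (\<lambda>n \<omega>. ennreal \<bar>simple_compensated N \<nu> (hs n) t \<omega> - J t \<omega>\<bar>)))"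

text \<open>\<open>\<eta>\<close> is the pure jump process obtained by integrating \<open>z\<close> against compensated \<open>N\<close>. Its
  integrand is deterministic, so no filtration is needed to define it; the one generated by \<open>B\<close>
  and \<open>\<eta>\<close> is built from it afterwards.\<close>

definition jump_diffusion_noise ::
  "'a measure \<Rightarrow> real \<Rightarrow> (real \<Rightarrow> 'a \<Rightarrow> real) \<Rightarrow> ('a \<Rightarrow> (real \<times> real) measure) \<Rightarrow> real measure \<Rightarrow>
     (real \<Rightarrow> 'a \<Rightarrow> real) \<Rightarrow> bool" where
  "jump_diffusion_noise P T B N \<nu> \<eta> \<longleftrightarrow>
     prob_space P \<and> 0 < T \<and> brownian_motion P T B \<and> levy_measure \<nu> \<and>
     poisson_random_measure P (restrict_space lborel {0..T} \<Otimes>\<^sub>M \<nu>) N \<and>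
     compensated_integral P T (\<lambda>_. sigma (space P) {}) N \<nu> (\<lambda>t \<omega> z. z) \<eta> \<and>
     prob_space.indep_set P
       (sigma_sets (space P) (process_events P B T))
       (sigma_sets (space P) (process_events P \<eta> T))"


section \<open>Controlled state process\<close>

abbreviation left_limit :: "(real \<Rightarrow> 'a \<Rightarrow> real) \<Rightarrow> real \<Rightarrow> 'a \<Rightarrow> real" where
  "left_limit X t \<omega> \<equiv> Lim (at_left t) (\<lambda>s. X s \<omega>)"

definition cadlag_on :: "real \<Rightarrow> (real \<Rightarrow> real) \<Rightarrow> bool" where
  "cadlag_on T h \<longleftrightarrow>
     (\<forall>t\<in>{0..<T}. (h \<longlongrightarrow> h t) (at_right t)) \<and> (\<forall>t\<in>{0<..T}. \<exists>l. (h \<longlongrightarrow> l) (at_left t))"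

text \<open>The state equation involves \<open>u(t-)\<close>, so a control must have left limits, and these must
  lie in \<open>U\<close> because the coefficients are only given there. The coefficients are total functions
  below, but they are never evaluated at control values outside \<open>U\<close>.\<close>

definition control ::
  "'a measure \<Rightarrow> real \<Rightarrow> (real \<Rightarrow> 'a measure) \<Rightarrow> real set \<Rightarrow> (real \<Rightarrow> 'a \<Rightarrow> real) \<Rightarrow> bool" where
  "control P T F U u \<longleftrightarrow>
     (\<forall>t\<ge>0. \<forall>\<omega>\<in>space P. u t \<omega> \<in> U) \<and>
     (\<lambda>(t, \<omega>). u t \<omega>) \<in> borel_measurable (restrict_space borel {0..T} \<Otimes>\<^sub>M P) \<and>
     (\<forall>t\<in>{0..T}. u t \<in> borel_measurable (F t)) \<and>
     (\<forall>\<omega>\<in>space P. \<forall>t\<in>{0<..T}. \<exists>l\<in>U. ((\<lambda>s. u s \<omega>) \<longlongrightarrow> l) (at_left t))"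

definition strong_solution ::
  "'a measure \<Rightarrow> real \<Rightarrow> (real \<Rightarrow> 'a \<Rightarrow> real) \<Rightarrow> ('a \<Rightarrow> (real \<times> real) measure) \<Rightarrow> real measure \<Rightarrow>
     (real \<Rightarrow> 'a \<Rightarrow> real) \<Rightarrow>
     (real \<Rightarrow> real \<Rightarrow> real \<Rightarrow> real) \<Rightarrow> (real \<Rightarrow> real \<Rightarrow> real \<Rightarrow> real) \<Rightarrow>
     (real \<Rightarrow> real \<Rightarrow> real \<Rightarrow> real \<Rightarrow> real) \<Rightarrow>
     (real \<Rightarrow> 'a \<Rightarrow> real) \<Rightarrow> real \<Rightarrow> (real \<Rightarrow> 'a \<Rightarrow> real) \<Rightarrow> bool" where
  "strong_solution P T B N \<nu> \<eta> b \<sigma> \<gamma> u x X \<longleftrightarrow>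
     (let F = generated_filtration P B \<eta> in
       (\<forall>t\<in>{0..T}. X t \<in> borel_measurable (F t)) \<and>
       (\<forall>\<omega>\<in>space P. cadlag_on T (\<lambda>t. X t \<omega>)) \<and>
       (AE \<omega> in P. X 0 \<omega> = x) \<and>
       (AE \<omega> in P. set_integrable lborel {0..T} (\<lambda>t. b t (X t \<omega>) (u t \<omega>))) \<and>
       (\<exists>I J.
          ito_integral P T F B (\<lambda>t \<omega>. \<sigma> t (X t \<omega>) (u t \<omega>)) I \<and>
          compensated_integral P T F N \<nu>
            (\<lambda>t \<omega> z. \<gamma> t (left_limit X t \<omega>) (left_limit u t \<omega>) z) J \<and>
          (\<forall>t\<in>{0..T}. AE \<omega> in P.
             X t \<omega> = x + (LINT s:{0..t}|lborel. b s (X s \<omega>) (u s \<omega>)) + I t \<omega> + J t \<omega>)))"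

definition unique_strong_solution ::
  "'a measure \<Rightarrow> real \<Rightarrow> (real \<Rightarrow> 'a \<Rightarrow> real) \<Rightarrow> ('a \<Rightarrow> (real \<times> real) measure) \<Rightarrow> real measure \<Rightarrow>
     (real \<Rightarrow> 'a \<Rightarrow> real) \<Rightarrow>
     (real \<Rightarrow> real \<Rightarrow> real \<Rightarrow> real) \<Rightarrow> (real \<Rightarrow> real \<Rightarrow> real \<Rightarrow> real) \<Rightarrow>
     (real \<Rightarrow> real \<Rightarrow> real \<Rightarrow> real \<Rightarrow> real) \<Rightarrow>
     (real \<Rightarrow> 'a \<Rightarrow> real) \<Rightarrow> real \<Rightarrow> bool" where
  "unique_strong_solution P T B N \<nu> \<eta> b \<sigma> \<gamma> u x \<longleftrightarrow>
     (\<exists>X. strong_solution P T B N \<nu> \<eta> b \<sigma> \<gamma> u x X) \<and>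
     (\<forall>X Y. strong_solution P T B N \<nu> \<eta> b \<sigma> \<gamma> u x X \<longrightarrow>
        strong_solution P T B N \<nu> \<eta> b \<sigma> \<gamma> u x Y \<longrightarrow>
        (AE \<omega> in P. \<forall>t\<in>{0..T}. X t \<omega> = Y t \<omega>))"

text \<open>Uniqueness holds up to indistinguishability, so for an admissible control the choice below
  does not affect expectations or almost sure statements.\<close>

definition state_process ::
  "'a measure \<Rightarrow> real \<Rightarrow> (real \<Rightarrow> 'a \<Rightarrow> real) \<Rightarrow> ('a \<Rightarrow> (real \<times> real) measure) \<Rightarrow> real measure \<Rightarrow>
     (real \<Rightarrow> 'a \<Rightarrow> real) \<Rightarrow>
     (real \<Rightarrow> real \<Rightarrow> real \<Rightarrow> real) \<Rightarrow> (real \<Rightarrow> real \<Rightarrow> real \<Rightarrow> real) \<Rightarrow>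
     (real \<Rightarrow> real \<Rightarrow> real \<Rightarrow> real \<Rightarrow> real) \<Rightarrow>
     (real \<Rightarrow> 'a \<Rightarrow> real) \<Rightarrow> real \<Rightarrow> real \<Rightarrow> 'a \<Rightarrow> real" where
  "state_process P T B N \<nu> \<eta> b \<sigma> \<gamma> u x =
     (SOME X. strong_solution P T B N \<nu> \<eta> b \<sigma> \<gamma> u x X)"


section \<open>Control problems\<close>

definition payoff ::
  "real \<Rightarrow> (real \<Rightarrow> real \<Rightarrow> real \<Rightarrow> real) \<Rightarrow> (real \<Rightarrow> real) \<Rightarrow>
     (real \<Rightarrow> 'a \<Rightarrow> real) \<Rightarrow> (real \<Rightarrow> 'a \<Rightarrow> real) \<Rightarrow> 'a \<Rightarrow> real" where
  "payoff T f g X u \<omega> = (LINT t:{0..T}|lborel. f t (X t \<omega>) (u t \<omega>)) + g (X T \<omega>)"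

definition admissible_controls ::
  "'a measure \<Rightarrow> real \<Rightarrow> (real \<Rightarrow> 'a \<Rightarrow> real) \<Rightarrow> ('a \<Rightarrow> (real \<times> real) measure) \<Rightarrow> real measure \<Rightarrow>
     (real \<Rightarrow> 'a \<Rightarrow> real) \<Rightarrow>
     (real \<Rightarrow> real \<Rightarrow> real \<Rightarrow> real) \<Rightarrow> (real \<Rightarrow> real \<Rightarrow> real \<Rightarrow> real) \<Rightarrow>
     (real \<Rightarrow> real \<Rightarrow> real \<Rightarrow> real \<Rightarrow> real) \<Rightarrow>
     (real \<Rightarrow> real \<Rightarrow> real \<Rightarrow> real) \<Rightarrow> (real \<Rightarrow> real) \<Rightarrow> real set \<Rightarrow>
     (real \<Rightarrow> 'a \<Rightarrow> real) set" where
  "admissible_controls P T B N \<nu> \<eta> b \<sigma> \<gamma> f g U =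
     {u. control P T (generated_filtration P B \<eta>) U u \<and>
         (\<forall>x. unique_strong_solution P T B N \<nu> \<eta> b \<sigma> \<gamma> u x \<and>
            (let X = state_process P T B N \<nu> \<eta> b \<sigma> \<gamma> u x in
               (AE \<omega> in P. set_integrable lborel {0..T} (\<lambda>t. f t (X t \<omega>) (u t \<omega>))) \<and>
               integrable P (payoff T f g X u)))}"

definition multipliers :: "'a measure \<Rightarrow> 'a measure \<Rightarrow> ('a \<Rightarrow> real) set" where
  "multipliers P FT = {\<mu> \<in> borel_measurable FT. integrable P \<mu>}"

text \<open>Expectation of the positive part minus that of the negative part. Since
  \<open>\<infinity> - \<infinity> = \<infinity>\<close> in \<^typ>\<open>ereal\<close>, a value below \<open>\<infinity>\<close> means that the positive part is integrable;
  in particular a finite supremum of such expectations rules out undefined ones.\<close>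

definition ext_expectation :: "'a measure \<Rightarrow> ('a \<Rightarrow> real) \<Rightarrow> ereal" where
  "ext_expectation P Y =
     enn2ereal (\<integral>\<^sup>+\<omega>. ennreal (Y \<omega>) \<partial>P) - enn2ereal (\<integral>\<^sup>+\<omega>. ennreal (- Y \<omega>) \<partial>P)"

definition solves_maximization :: "('c \<Rightarrow> ereal) \<Rightarrow> 'c set \<Rightarrow> real \<Rightarrow> 'c \<Rightarrow> bool" where
  "solves_maximization J A v u \<longleftrightarrow> u \<in> A \<and> J u = ereal v \<and> (SUP a\<in>A. J a) = ereal v"

end

theory Submission
  imports Defs
begin

text \<open>
  This is the sufficiency direction of the Lagrange multiplier method. The multiplier term
  \<open>\<mu>0 M(X(T))\<close> vanishes almost surely along every feasible control, so on the feasible set the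
  penalised objective for \<open>\<mu>0\<close> and the original objective are the same function. The maximizer of
  the penalised problem over all of \<open>A\<close> is feasible by hypothesis; a maximizer that happens to lie
  in a smaller set also maximizes over that set, with the same value. The
  multiplier may be random because the two objectives are compared pointwise in \<open>\<omega>\<close>, before
  expectations are taken.

  The lemma \<open>ext_expectation_cong_AE\<close> identifies the two objectives on the feasible set, and
  \<open>solves_maximization_subset\<close> passes from the larger problem to the smaller one.
\<close>

text \<open>
  Shrinking the competition cannot hurt a competitor who stays in it. The two objectives
  need to agree only on the smaller set: a penalty for infeasibility acts outside it.
\<close>

lemma solves_maximization_subset:
  assumes sol: "solves_maximization J A v u"
    and mem: "u \<in> S"
    and sub: "S \<subseteq> A"
    and eq: "\<And>a. a \<in> S \<Longrightarrow> K a = J a"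
  shows "solves_maximization K S v u"
proof -
  have Ju: "J u = ereal v" and sup: "(SUP a\<in>A. J a) = ereal v"
    using sol by (auto simp: solves_maximization_def)
  have Ku: "K u = ereal v"
    using eq[OF mem] Ju by simp
  have "(SUP a\<in>S. K a) = ereal v"
  proof (rule antisym)
    have "(SUP a\<in>S. K a) = (SUP a\<in>S. J a)"
      using eq by (intro SUP_cong) auto
    also have "\<dots> \<le> (SUP a\<in>A. J a)"
      using sub by (intro SUP_subset_mono) auto
    finally show "(SUP a\<in>S. K a) \<le> ereal v"
      using sup by simp
    show "ereal v \<le> (SUP a\<in>S. K a)"
      using SUP_upper[OF mem, of K] Ku by simp
  qed
  then show ?thesis
    using mem Ku by (simp add: solves_maximization_def)
qed

text \<open>
  The positive and negative parts agree almost everywhere, and their nonnegative integrals are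
  defined for arbitrary functions. The lemma thus applies to an integrable multiplier times an
  integrable constraint, a product that need not be integrable.
\<close>

lemma ext_expectation_cong_AE:
  assumes "AE \<omega> in P. Y \<omega> = Z \<omega>"
  shows "ext_expectation P Y = ext_expectation P Z"
proof -
  have "(\<integral>\<^sup>+\<omega>. ennreal (Y \<omega>) \<partial>P) = (\<integral>\<^sup>+\<omega>. ennreal (Z \<omega>) \<partial>P)"
    using assms by (intro nn_integral_cong_AE) auto
  moreover have "(\<integral>\<^sup>+\<omega>. ennreal (- Y \<omega>) \<partial>P) = (\<integral>\<^sup>+\<omega>. ennreal (- Z \<omega>) \<partial>P)"
    using assms by (intro nn_integral_cong_AE) auto
  ultimately show ?thesis
    by (simp add: ext_expectation_def)
qed

theorem theorem2p2:
  fixes P :: "'a measure" and T :: real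
    and B \<eta> :: "real \<Rightarrow> 'a \<Rightarrow> real"
    and N :: "'a \<Rightarrow> (real \<times> real) measure" and \<nu> :: "real measure"
    and b \<sigma> :: "real \<Rightarrow> real \<Rightarrow> real \<Rightarrow> real"
    and \<gamma> :: "real \<Rightarrow> real \<Rightarrow> real \<Rightarrow> real \<Rightarrow> real"
    and f :: "real \<Rightarrow> real \<Rightarrow> real \<Rightarrow> real" and g M :: "real \<Rightarrow> real"
    and U :: "real set" and x :: real
    and \<phi> :: "('a \<Rightarrow> real) \<Rightarrow> real \<Rightarrow> real"
    and ustar :: "('a \<Rightarrow> real) \<Rightarrow> real \<Rightarrow> 'a \<Rightarrow> real"
    and \<mu>0 :: "'a \<Rightarrow> real"
  defines "A \<equiv> admissible_controls P T B N \<nu> \<eta> b \<sigma> \<gamma> f g U"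
    and "X \<equiv> state_process P T B N \<nu> \<eta> b \<sigma> \<gamma>"
    and "\<Lambda> \<equiv> multipliers P (generated_filtration P B \<eta> T)"
  assumes noise: "jump_diffusion_noise P T B N \<nu> \<eta>"
    and cont_f: "continuous_on ({0..} \<times> UNIV \<times> UNIV) (\<lambda>(t, y, v). f t y v)"
    and cont_g: "continuous_on UNIV g"
    and cont_M: "continuous_on UNIV M"
    and integrable_M: "\<forall>u\<in>A. \<forall>y. integrable P (\<lambda>\<omega>. M (X u y T \<omega>))"
    and unconstrained: "\<forall>\<mu>\<in>\<Lambda>.
      solves_maximization
        (\<lambda>u. ext_expectation P (\<lambda>\<omega>. payoff T f g (X u x) u \<omega> + \<mu> \<omega> * M (X u x T \<omega>)))
        A (\<phi> \<mu> x) (ustar \<mu>)"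
    and multiplier: "\<mu>0 \<in> \<Lambda>"
    and constraint: "AE \<omega> in P. M (X (ustar \<mu>0) x T \<omega>) = 0"
  shows "solves_maximization
      (\<lambda>u. ext_expectation P (payoff T f g (X u x) u))
      {u \<in> A. AE \<omega> in P. M (X u x T \<omega>) = 0} (\<phi> \<mu>0 x) (ustar \<mu>0)"
proof -
  have star: "solves_maximization
      (\<lambda>u. ext_expectation P (\<lambda>\<omega>. payoff T f g (X u x) u \<omega> + \<mu>0 \<omega> * M (X u x T \<omega>)))
      A (\<phi> \<mu>0 x) (ustar \<mu>0)"
    using unconstrained multiplier by blast
  show ?thesis
  proof (rule solves_maximization_subset[OF star])
    show "ustar \<mu>0 \<in> {u \<in> A. AE \<omega> in P. M (X u x T \<omega>) = 0}"
      using star constraint by (simp add: solves_maximization_def)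
    show "{u \<in> A. AE \<omega> in P. M (X u x T \<omega>) = 0} \<subseteq> A"
      by blast
    fix u
    assume "u \<in> {u \<in> A. AE \<omega> in P. M (X u x T \<omega>) = 0}"
    then have "AE \<omega> in P. M (X u x T \<omega>) = 0"
      by blast
    then show "ext_expectation P (payoff T f g (X u x) u) =
        ext_expectation P (\<lambda>\<omega>. payoff T f g (X u x) u \<omega> + \<mu>0 \<omega> * M (X u x T \<omega>))"
      by (intro ext_expectation_cong_AE) auto
  qed
qed

end
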